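(* Let $0<\beta<1$ and $q = 1/(1-\beta)$. The map $f\mapsto \big(\widetilde{M}_\beta f\big)'$ is not continuous from $BV(\mathbb{R})$ to $L^q(\mathbb{R})$, i.e. there is a sequence $\{f_j\}_{j\ge1}\subset BV(\mathbb{R})$ and a function $f\in BV(\mathbb{R})$ such that $\|f_j - f\|_{BV(\mathbb{R})}\to 0$ as $j\to\infty$ but $$\big\|\big(\widetilde{M}_\beta f_j\big)' - \big(\widetilde{M}_\beta f\big)'\big\|_{L^q(\mathbb{R})} = \mathrm{Var}_q\big(\widetilde{M}_\beta f_j - \widetilde{M}_\beta f\big) \not\to 0$$ as $j\to\infty$.
   Context: $BV(\mathbb{R})$ is the space of functions $f:\mathbb{R}\to\mathbb{R}$ of bounded total variation $\mathrm{Var}(f)$, with norm $\|f\|_{BV(\mathbb{R})} = |f(-\infty)| + \mathrm{Var}(f)$, where $f(-\infty)=\lim_{x\to-\infty}f(x)$. The uncentered fractional maximal operator is $$\widetilde{M}_\beta f(x) = \sup_{I\ni x} \frac{1}{m(I)^{1-\beta}}\int_I |f(y)|\,dy,$$ the supremum over bounded open intervals $I$ containing $x$, with $m(I)$ the length of $I$. For $g:\mathbb{R}\to\mathbb{R}$ and $1\le q<\infty$ the Riesz $q$-variation is $$\mathrm{Var}_q(g) = \sup_{\mathcal{P}}\left(\sum_{n=1}^{N-1}\frac{|g(x_{n+1})-g(x_n)|^q}{|x_{n+1}-x_n|^{q-1}}\right)^{1/q},$$ the supremum over all finite partitions $\mathcal{P}=\{x_1<x_2<\cdots<x_N\}$.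 For $1<q<\infty$, by a classical theorem of F. Riesz, $\mathrm{Var}_q(g)<\infty$ if and only if $g$ is absolutely continuous with $g'\in L^q(\mathbb{R})$, and then $\|g'\|_{L^q(\mathbb{R})}=\mathrm{Var}_q(g)$. It is known (Carneiro and Madrid) that if $f\in BV(\mathbb{R})$ and $\widetilde{M}_\beta f\not\equiv\infty$, then $\widetilde{M}_\beta f$ is absolutely continuous and $\|(\widetilde{M}_\beta f)'\|_{L^q(\mathbb{R})}\le 8^{1/q}\,\mathrm{Var}(f)$; if $\widetilde{M}_\beta f\equiv\infty$ one sets $(\widetilde{M}_\beta f)'\equiv 0$. In the displayed identity, the existence of $\mathrm{Var}_q(\widetilde{M}_\beta f_j-\widetilde{M}_\beta f)$ includes that $\widetilde{M}_\beta f_j$ and $\widetilde{M}_\beta f$ are finite-valued. *)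

theory Defs
  imports "HOL-Analysis.Analysis"
begin

text \<open>
  A finite partition x_0 < ... < x_N of the line is encoded as a pair (N, p), where only the
  values of p at 0, ..., N matter. The degenerate case N = 0 contributes 0 to the suprema below.
\<close>

definition partitions :: "(nat \<times> (nat \<Rightarrow> real)) set" where
  "partitions = {(N, p). strict_mono_on {..N} p}"

definition total_variation :: "(real \<Rightarrow> real) \<Rightarrow> ennreal" where
  "total_variation f =
     (SUP (N, p) \<in> partitions. ennreal (\<Sum>n<N. \<bar>f (p (Suc n)) - f (p n)\<bar>))"

definition BV :: "(real \<Rightarrow> real) set" where
  "BV = {f. total_variation f < \<infinity>}"

definition BV_norm :: "(real \<Rightarrow> real) \<Rightarrow> real" where
  "BV_norm f = \<bar>Lim at_bot f\<bar> + enn2real (total_variation f)"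

definition riesz_variation :: "real \<Rightarrow> (real \<Rightarrow> real) \<Rightarrow> ennreal" where
  "riesz_variation q g =
     (SUP (N, p) \<in> partitions.
        ennreal ((\<Sum>n<N. \<bar>g (p (Suc n)) - g (p n)\<bar> powr q
                         / \<bar>p (Suc n) - p n\<bar> powr (q - 1)) powr (1 / q)))"

text \<open>
  Functions of bounded variation are Borel measurable, so for them the integral below is the
  usual one.
\<close>

definition frac_maximal :: "real \<Rightarrow> (real \<Rightarrow> real) \<Rightarrow> real \<Rightarrow> ennreal" where
  "frac_maximal \<beta> f x =
     (SUP (a, b) \<in> {(a, b). a < x \<and> x < b}.
        (\<integral>\<^sup>+ y \<in> {a<..<b}. ennreal \<bar>f y\<bar> \<partial>lborel) / ennreal ((b - a) powr (1 - \<beta>)))"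

text \<open>The real-valued version; meaningful only where the maximal function is finite.\<close>

definition frac_maximal_real :: "real \<Rightarrow> (real \<Rightarrow> real) \<Rightarrow> real \<Rightarrow> real" where
  "frac_maximal_real \<beta> f x = enn2real (frac_maximal \<beta> f x)"

text \<open>
  The value of \<^const>\<open>deriv\<close> is arbitrary at points of non-differentiability, so this function is
  meaningful as an element of a Lebesgue space only together with differentiability almost
  everywhere.
\<close>

definition frac_maximal_deriv :: "real \<Rightarrow> (real \<Rightarrow> real) \<Rightarrow> real \<Rightarrow> real" where
  "frac_maximal_deriv \<beta> f x =
     (if \<forall>y. frac_maximal \<beta> f y = \<infinity> then 0 else deriv (frac_maximal_real \<beta> f) x)"

definition Lq_space :: "real \<Rightarrow> (real \<Rightarrow> real) set" where
  "Lq_space q = {h \<in> borel_measurable lebesgue. integrable lebesgue (\<lambda>x. \<bar>h x\<bar> powr q)}"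

definition Lq_norm :: "real \<Rightarrow> (real \<Rightarrow> real) \<Rightarrow> real" where
  "Lq_norm q h = (LINT x|lebesgue. \<bar>h x\<bar> powr q) powr (1 / q)"

end

theory Submission
  imports Defs
begin

text \<open>
  Perturb \<open>f = 1\<^bsub>[-1,1]\<^esub>\<close> by a plateau of tiny height \<open>c\<close> on a huge interval \<open>[-R, R]\<close>. Its variation is
  \<open>2c\<close>, yet if \<open>c (2R)\<^sup>\<beta>\<close> is large, then \<open>[-R, R]\<close> is the optimal interval for each of its
  points, so the maximal function becomes constant on \<open>[-R, R]\<close>. Hence all the oscillation that the
  maximal function of \<open>f\<close> has there survives in the difference. The maximal functions
  are explicit, continuous and piecewise smooth, so only this case of Riesz' theorem is needed.
\<close>

section \<open>The Riesz variation of a piecewise differentiable function\<close>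

text \<open>The graph of \<open>t powr q\<close> lies above its tangent at \<open>m\<close> by
  convexity. Taking this from Young's inequality with conjugate exponents \<open>q\<close> and
  \<open>q / (q - 1)\<close> avoids a separate case for \<open>m = 0\<close>.\<close>

lemma young_tangent:
  fixes m q t :: real
  assumes "1 < q" "0 \<le> m" "0 \<le> t"
  shows "q * m powr (q - 1) * t - (q - 1) * m powr q \<le> t powr q"
proof -
  have "t * m powr (q - 1) \<le> t powr q / q + (m powr (q - 1)) powr (q / (q - 1)) / (q / (q - 1))"
    using assms by (intro Youngs_inequality) (auto simp: field_simps)
  moreover have "(m powr (q - 1)) powr (q / (q - 1)) = m powr q"
    using assms by (simp add: powr_powr)
  ultimately have "q * (t * m powr (q - 1)) \<le> q * (t powr q / q + m powr q * ((q - 1) / q))"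
    using assms by (intro mult_left_mono) auto
  also have "\<dots> = t powr q + (q - 1) * m powr q"
    using assms by (simp add: field_simps)
  finally show ?thesis by (simp add: mult_ac)
qed

text \<open>
  Hoelder's inequality on an interval, obtained by integrating the tangent line of \<open>t powr q\<close>
  at the mean slope.
\<close>

lemma riesz_quotient_le_integral:
  fixes g h :: "real \<Rightarrow> real"
  assumes "1 < q" "x < y"
    and g: "g \<in> borel_measurable borel"
    and F: "(\<lambda>t. \<bar>g t\<bar> powr q) integrable_on {x..y}"
    and I: "(g has_integral (h y - h x)) {x..y}"
  shows "\<bar>h y - h x\<bar> powr q / \<bar>y - x\<bar> powr (q - 1) \<le> integral {x..y} (\<lambda>t. \<bar>g t\<bar> powr q)"
proof -
  \<comment> \<open>On a bounded interval the constant \<open>1\<close> is integrable, so this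
    domination turns integrability of the \<open>q\<close>-th power into absolute integrability of
    \<open>g\<close>.\<close>
  have bd: "\<bar>g t\<bar> \<le> 1 + \<bar>g t\<bar> powr q" for t
  proof (cases "\<bar>g t\<bar> \<le> 1")
    case False
    then have "\<bar>g t\<bar> powr 1 \<le> \<bar>g t\<bar> powr q" using assms by (intro powr_mono) auto
    with False show ?thesis by simp
  qed (simp add: add_increasing2)
  have gl: "g \<in> borel_measurable (lebesgue_on {x..y})"
    using g by (simp add: measurable_completion measurable_restrict_space1)
  have "g absolutely_integrable_on {x..y}"
  proof (rule measurable_bounded_by_integrable_imp_absolutely_integrable[OF gl])
    show "(\<lambda>t. 1 + \<bar>g t\<bar> powr q) integrable_on {x..y}"
      using F by (intro integrable_add) auto
  qed (use bd in auto)
  then have ag: "(\<lambda>t. \<bar>g t\<bar>) integrable_on {x..y}" and gi: "g integrable_on {x..y}"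
    by (auto simp: absolutely_integrable_on_def)
  have le: "\<bar>h y - h x\<bar> \<le> integral {x..y} (\<lambda>t. \<bar>g t\<bar>)"
    using integral_norm_bound_integral[OF gi ag] integral_unique[OF I] by simp
  define m where "m = \<bar>h y - h x\<bar> / (y - x)"
  have m0: "0 \<le> m" and my: "m * (y - x) = \<bar>h y - h x\<bar>"
    using assms by (auto simp: m_def)
  have "\<bar>h y - h x\<bar> powr q / \<bar>y - x\<bar> powr (q - 1) = m powr q * (y - x)"
  proof -
    have "(y - x) powr q = (y - x) powr (q - 1) * (y - x)"
      using \<open>x < y\<close> powr_add[of "y - x" "q - 1" 1] by simp
    then show ?thesis
      using assms by (simp add: m_def powr_divide)
  qed
  \<comment> \<open>The Riesz quotient is now \<open>m powr q\<close> times the length. Splitting it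
    as \<open>q\<close> copies minus \<open>q - 1\<close> copies produces the tangent line at
    \<open>m\<close>, which can be integrated against \<open>\<bar>g t\<bar>\<close>.\<close>
  also have "m powr q = m powr (q - 1) * m"
    using powr_add[of m "q - 1" 1] m0 by simp
  also have "m powr (q - 1) * m * (y - x) = q * m powr (q - 1) * (m * (y - x)) - (q - 1) * (m powr (q - 1) * m) * (y - x)"
    by (simp add: algebra_simps)
  also have "\<dots> \<le> q * m powr (q - 1) * integral {x..y} (\<lambda>t. \<bar>g t\<bar>) - (q - 1) * m powr q * (y - x)"
    using le assms powr_add[of m "q - 1" 1] m0 unfolding my by (auto intro!: mult_left_mono)
  also have "\<dots> = integral {x..y} (\<lambda>t. q * m powr (q - 1) * \<bar>g t\<bar> - (q - 1) * m powr q)"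
    using ag assms by (subst integral_diff) (auto intro: integrable_on_mult_right)
  also have "\<dots> \<le> integral {x..y} (\<lambda>t. \<bar>g t\<bar> powr q)"
    using young_tangent[OF \<open>1 < q\<close> m0] ag F
    by (intro integral_le integrable_diff integrable_on_mult_right) auto
  finally show ?thesis .
qed

text \<open>The bounds on adjacent intervals add up, and the integrand is nonnegative, so the rest
  of the line only increases the integral.\<close>

lemma riesz_sum_le_integral:
  fixes g h :: "real \<Rightarrow> real"
  assumes "1 < q"
    and g: "g \<in> borel_measurable borel"
    and F: "integrable lborel (\<lambda>t. \<bar>g t\<bar> powr q)"
    and I: "\<And>x y. x < y \<Longrightarrow> (g has_integral (h y - h x)) {x..y}"
    and p: "strict_mono_on {..N} p"
  shows "(\<Sum>n<N. \<bar>h (p (Suc n)) - h (p n)\<bar> powr q / \<bar>p (Suc n) - p n\<bar> powr (q - 1))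
           \<le> (LINT t|lborel. \<bar>g t\<bar> powr q)"
proof -
  let ?F = "\<lambda>t. \<bar>g t\<bar> powr q"
  have FU: "?F integrable_on UNIV" using F by (rule integrable_on_lborel)
  have FI: "?F integrable_on {x..y}" for x y
    using FU by (rule integrable_on_subinterval) simp
  have less: "p n < p (Suc n)" if "n < N" for n
    using p that by (auto simp: strict_mono_on_def)
  have "(\<Sum>n<M. \<bar>h (p (Suc n)) - h (p n)\<bar> powr q / \<bar>p (Suc n) - p n\<bar> powr (q - 1))
           \<le> integral {p 0..p M} ?F" if "M \<le> N" for M
    using that
  proof (induction M)
    case (Suc M)
    have "p 0 \<le> p M" using p Suc.prems by (cases "M = 0") (auto simp: strict_mono_on_def intro!: less_imp_le)
    then have "integral {p 0..p M} ?F + integral {p M..p (Suc M)} ?F = integral {p 0..p (Suc M)} ?F"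
      using less[of M] Suc.prems FI by (intro Henstock_Kurzweil_Integration.integral_combine) auto
    then show ?case
      using Suc riesz_quotient_le_integral[OF \<open>1 < q\<close> less g FI I[OF less], of M] by simp
  qed simp
  from this[of N] have "(\<Sum>n<N. \<bar>h (p (Suc n)) - h (p n)\<bar> powr q / \<bar>p (Suc n) - p n\<bar> powr (q - 1))
           \<le> integral {p 0..p N} ?F" by simp
  also have "\<dots> \<le> integral UNIV ?F"
    using FU FI by (intro integral_subset_le) auto
  also have "\<dots> = (LINT t|lborel. ?F t)"
    using F by (rule integral_lborel)
  finally show ?thesis .
qed

text \<open>Both endpoints move, so the limit does not come directly from the definition of the
  derivative. Since \<open>x\<close> lies between \<open>u n\<close> and \<open>v n\<close>, the
  first-order errors on the two sides are small multiples of distances that sum to exactly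
  \<open>v n - u n\<close>.\<close>

lemma straddle_slope:
  fixes h :: "real \<Rightarrow> real"
  assumes h: "(h has_real_derivative D) (at x)"
    and uv: "\<And>n. u n \<le> x" "\<And>n. x < v n" and lim: "(\<lambda>n. v n - u n) \<longlonglongrightarrow> 0"
  shows "(\<lambda>n. (h (v n) - h (u n)) / (v n - u n)) \<longlonglongrightarrow> D"
proof (rule LIMSEQ_I)
  fix e :: real assume "0 < e"
  then have "0 < e / 2" by simp
  with h obtain d where d: "0 < d"
    "\<And>y. \<bar>y - x\<bar> < d \<Longrightarrow> \<bar>h y - h x - D * (y - x)\<bar> \<le> e / 2 * \<bar>y - x\<bar>"
    unfolding has_field_derivative_def has_derivative_at_alt real_norm_def by blast
  obtain n0 where n0: "\<And>n. n \<ge> n0 \<Longrightarrow> \<bar>v n - u n\<bar> < d"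
    using LIMSEQ_D[OF lim d(1)] by auto
  show "\<exists>no. \<forall>n\<ge>no. norm ((h (v n) - h (u n)) / (v n - u n) - D) < e"
  proof (intro exI allI impI)
    fix n assume n: "n0 \<le> n"
    have "\<bar>v n - x\<bar> < d" "\<bar>u n - x\<bar> < d" "\<bar>v n - x\<bar> = v n - x" "\<bar>u n - x\<bar> = x - u n"
      using n0[OF n] uv[of n] by linarith+
    with d(2)[of "v n"] d(2)[of "u n"]
    have "\<bar>h (v n) - h x - D * (v n - x)\<bar> \<le> e / 2 * (v n - x)"
         "\<bar>h (u n) - h x - D * (u n - x)\<bar> \<le> e / 2 * (x - u n)"
      by simp_all
    then have "\<bar>h (v n) - h (u n) - D * (v n - u n)\<bar> \<le> e / 2 * (v n - u n)"
      using abs_triangle_ineq4[of "h (v n) - h x - D * (v n - x)" "h (u n) - h x - D * (u n - x)"]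
      by (simp add: right_diff_distrib)
    moreover have "(h (v n) - h (u n)) / (v n - u n) - D
        = (h (v n) - h (u n) - D * (v n - u n)) / (v n - u n)"
      using uv[of n] by (simp add: diff_divide_distrib)
    ultimately have "\<bar>(h (v n) - h (u n)) / (v n - u n) - D\<bar> \<le> e / 2"
      using uv[of n] by (simp add: abs_divide pos_divide_le_eq)
    with \<open>0 < e\<close> show "norm ((h (v n) - h (u n)) / (v n - u n) - D) < e" by simp
  qed
qed

text \<open>
  Fatou's lemma for the step functions given by the difference quotients along the uniform
  partitions of \<open>[-(n+1), n+1]\<close> with step \<open>1/(n+1)\<close>.
\<close>

lemma nn_integral_deriv_le_riesz_variation:
  fixes g h :: "real \<Rightarrow> real"
  assumes "1 < q" "0 \<le> V" and V: "riesz_variation q h \<le> ennreal V"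
    and g: "g \<in> borel_measurable borel"
    and D: "AE x in lborel. (h has_real_derivative g x) (at x)"
  shows "(\<integral>\<^sup>+x. ennreal (\<bar>g x\<bar> powr q) \<partial>lborel) \<le> ennreal (V powr q)"
proof -
  define r :: "nat \<Rightarrow> real" where "r n = real (Suc n)" for n
  define p where "p n k = - r n + real k / r n" for n k
  define N where "N n = 2 * Suc n * Suc n" for n
  define c where "c n k = \<bar>(h (p n (Suc k)) - h (p n k)) / (p n (Suc k) - p n k)\<bar> powr q" for n k
  \<comment> \<open>Half-open cells make each point of the partitioned range lie in exactly one of
    them.\<close>
  define S where "S n x = (\<Sum>k<N n. ennreal (c n k) * indicator {p n k..<p n (Suc k)} x)" for n x
  have r: "0 < r n" for n by (simp add: r_def)
  have step: "p n (Suc k) - p n k = 1 / r n" for n k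
    using r[of n] by (simp add: p_def field_simps)
  have int_S: "(\<integral>\<^sup>+x. S n x \<partial>lborel) \<le> ennreal (V powr q)" for n
  proof -
    have sm: "strict_mono_on {..N n} (p n)"
      using r[of n] by (auto simp: strict_mono_on_def p_def divide_strict_right_mono)
    let ?s = "\<Sum>k<N n. \<bar>h (p n (Suc k)) - h (p n k)\<bar> powr q / \<bar>p n (Suc k) - p n k\<bar> powr (q - 1)"
    have s0: "0 \<le> ?s" by (intro sum_nonneg) auto
    have "ennreal (?s powr (1 / q)) \<le> riesz_variation q h"
      unfolding riesz_variation_def
      by (rule SUP_upper2[of "(N n, p n)"]) (use sm in \<open>auto simp: partitions_def\<close>)
    then have "ennreal (?s powr (1 / q)) \<le> ennreal V" using V by (rule order_trans)
    then have "?s powr (1 / q) \<le> V" using \<open>0 \<le> V\<close> by simp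
    then have "(?s powr (1 / q)) powr q \<le> V powr q"
      using \<open>1 < q\<close> by (intro powr_mono2) auto
    then have sV: "?s \<le> V powr q" using \<open>1 < q\<close> s0 by (simp add: powr_powr)
    \<comment> \<open>Multiplying the \<open>q\<close>-th power of a slope by the cell length leaves
      the power \<open>q - 1\<close> of that length in the denominator: the integral of the step
      function is the Riesz sum.\<close>
    have c_eq: "c n k * (1 / r n) = \<bar>h (p n (Suc k)) - h (p n k)\<bar> powr q / \<bar>p n (Suc k) - p n k\<bar> powr (q - 1)" for k
    proof -
      have "(1 / r n) powr q = (1 / r n) powr (q - 1) * (1 / r n)"
        using r[of n] powr_add[of "1 / r n" "q - 1" 1] by simp
      then show ?thesis
        using r[of n] unfolding c_def step by (simp add: abs_mult powr_divide powr_mult mult_ac flip: right_diff_distrib)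
    qed
    have "(\<integral>\<^sup>+x. S n x \<partial>lborel) = (\<Sum>k<N n. ennreal (c n k) * emeasure lborel {p n k..<p n (Suc k)})"
      unfolding S_def by (subst nn_integral_sum) (auto simp: nn_integral_cmult_indicator)
    also have "\<dots> = (\<Sum>k<N n. ennreal (c n k * (1 / r n)))"
    proof (rule sum.cong[OF refl])
      fix k
      have "p n k \<le> p n (Suc k)" using step[of n k] r[of n] by (simp add: algebra_simps)
      then show "ennreal (c n k) * emeasure lborel {p n k..<p n (Suc k)} = ennreal (c n k * (1 / r n))"
        using r[of n] step[of n k] by (subst ennreal_mult) (auto simp: c_def)
    qed
    also have "\<dots> = ennreal ?s"
      unfolding c_eq by (rule sum_ennreal) auto
    finally show ?thesis using sV by (simp add: ennreal_leI)
  qed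
  have lim_S: "(\<lambda>n. S n x) \<longlonglongrightarrow> ennreal (\<bar>g x\<bar> powr q)"
    if D: "(h has_real_derivative g x) (at x)" for x
  proof -
    \<comment> \<open>The endpoints \<open>u n\<close>, \<open>v n\<close> use the integer floor
      rather than \<open>k n\<close>, so that they enclose \<open>x\<close> for every
      \<open>n\<close>. They are partition points once \<open>\<bar>x\<bar> < r n\<close>, when the
      floor is nonnegative.\<close>
    define k where "k n = nat \<lfloor>(x + r n) * r n\<rfloor>" for n
    define u where "u n = real_of_int \<lfloor>(x + r n) * r n\<rfloor> / r n - r n" for n
    define v where "v n = (real_of_int \<lfloor>(x + r n) * r n\<rfloor> + 1) / r n - r n" for n
    have ux: "u n \<le> x" for n
      using r[of n] unfolding u_def by (simp add: pos_divide_le_eq algebra_simps)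
    have xv: "x < v n" for n
    proof -
      have "(x + r n) * r n < real_of_int \<lfloor>(x + r n) * r n\<rfloor> + 1" by linarith
      then have "x + r n < (real_of_int \<lfloor>(x + r n) * r n\<rfloor> + 1) / r n"
        using r[of n] by (simp add: pos_less_divide_eq)
      then show ?thesis by (simp add: v_def)
    qed
    have vu: "v n - u n = 1 / r n" for n
      using r[of n] by (simp add: u_def v_def add_divide_distrib)
    have "(\<lambda>n. v n - u n) \<longlonglongrightarrow> 0"
      unfolding vu r_def using LIMSEQ_inverse_real_of_nat by (simp add: inverse_eq_divide)
    from straddle_slope[OF D ux xv this]
    have "(\<lambda>n. \<bar>(h (v n) - h (u n)) / (v n - u n)\<bar> powr q) \<longlonglongrightarrow> \<bar>g x\<bar> powr q"
      using \<open>1 < q\<close> by (intro tendsto_powr' tendsto_rabs tendsto_const) auto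
    then have "(\<lambda>n. ennreal (\<bar>(h (v n) - h (u n)) / (v n - u n)\<bar> powr q)) \<longlonglongrightarrow> ennreal (\<bar>g x\<bar> powr q)"
      by (rule tendsto_ennrealI)
    moreover have "\<forall>\<^sub>F n in sequentially. ennreal (\<bar>(h (v n) - h (u n)) / (v n - u n)\<bar> powr q) = S n x"
    proof (rule eventually_mono[OF eventually_ge_at_top[of "nat \<lceil>\<bar>x\<bar>\<rceil>"]])
      fix n assume n: "nat \<lceil>\<bar>x\<bar>\<rceil> \<le> n"
      have xr: "\<bar>x\<bar> < r n" using n unfolding r_def by linarith
      have pos: "0 \<le> (x + r n) * r n" using xr r[of n] by simp
      have lt: "(x + r n) * r n < real (N n)"
      proof -
        have "(x + r n) * r n < (2 * r n) * r n" using xr r[of n] by (intro mult_strict_right_mono) auto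
        then show ?thesis by (simp add: N_def r_def algebra_simps)
      qed
      have rk: "real (k n) = real_of_int \<lfloor>(x + r n) * r n\<rfloor>" using pos by (simp add: k_def)
      have kN: "k n < N n"
        using lt rk by (metis of_int_floor_le of_nat_less_iff order_le_less_trans)
      have uv: "u n = p n (k n)" "v n = p n (Suc (k n))"
        by (simp_all add: u_def v_def p_def rk)
      have uniq: "x \<notin> {p n j..<p n (Suc j)}" if "j \<noteq> k n" for j
      proof
        assume "x \<in> {p n j..<p n (Suc j)}"
        then have "real j / r n \<le> x + r n" "x + r n < real (Suc j) / r n" by (auto simp: p_def)
        then have "real j \<le> (x + r n) * r n" "(x + r n) * r n < real j + 1"
          using r[of n] by (auto simp: pos_divide_le_eq pos_less_divide_eq)
        then have "\<lfloor>(x + r n) * r n\<rfloor> = int j" by (intro floor_unique) auto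
        with that show False by (simp add: k_def)
      qed
      have "S n x = (\<Sum>j<N n. if j = k n then ennreal (c n (k n)) else 0)"
        unfolding S_def using uniq ux[of n] xv[of n] by (intro sum.cong) (auto simp: uv)
      also have "\<dots> = ennreal (c n (k n))" using kN by simp
      finally show "ennreal (\<bar>(h (v n) - h (u n)) / (v n - u n)\<bar> powr q) = S n x"
        by (simp add: c_def uv)
    qed
    ultimately show ?thesis by (rule Lim_transform_eventually)
  qed
  have "(\<integral>\<^sup>+x. ennreal (\<bar>g x\<bar> powr q) \<partial>lborel) = (\<integral>\<^sup>+x. liminf (\<lambda>n. S n x) \<partial>lborel)"
    using D by (intro nn_integral_cong_AE) (auto intro!: lim_imp_Liminf[symmetric] lim_S)
  also have "\<dots> \<le> liminf (\<lambda>n. \<integral>\<^sup>+x. S n x \<partial>lborel)"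
    unfolding S_def by (intro nn_integral_liminf) measurable
  also have "\<dots> \<le> ennreal (V powr q)"
    using Liminf_mono[of "\<lambda>n. \<integral>\<^sup>+x. S n x \<partial>lborel" "\<lambda>n. ennreal (V powr q)" sequentially] int_S
    by (simp add: Liminf_const)
  finally show ?thesis .
qed

text \<open>Continuity at the finitely many exceptional points makes \<open>h\<close> a primitive of
  \<open>g\<close> across them, which gives the upper bound. The lower bound is the Fatou estimate,
  applicable because the upper bound makes the variation finite.\<close>

lemma riesz_variation_eq_Lq_norm:
  fixes g h :: "real \<Rightarrow> real"
  assumes q: "1 < q" and h: "continuous_on UNIV h" and X: "finite X"
    and D: "\<And>x. x \<notin> X \<Longrightarrow> (h has_real_derivative g x) (at x)"
    and g: "g \<in> borel_measurable borel"
    and F: "integrable lborel (\<lambda>t. \<bar>g t\<bar> powr q)"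
  shows "riesz_variation q h = ennreal ((LINT t|lborel. \<bar>g t\<bar> powr q) powr (1 / q))"
proof (rule antisym)
  let ?J = "LINT t|lborel. \<bar>g t\<bar> powr q"
  have J0: "0 \<le> ?J" by simp
  have I: "(g has_integral (h y - h x)) {x..y}" if "x < y" for x y
    using that D h X
    by (intro fundamental_theorem_of_calculus_strong[OF X])
       (auto simp: has_real_derivative_iff_has_vector_derivative[symmetric] intro: continuous_on_subset)
  show le: "riesz_variation q h \<le> ennreal (?J powr (1 / q))"
    unfolding riesz_variation_def
  proof (rule SUP_least, clarify)
    fix N p assume "(N, p) \<in> partitions"
    then have "strict_mono_on {..N} p" by (simp add: partitions_def)
    from riesz_sum_le_integral[OF q g F I this]
    show "ennreal ((\<Sum>n<N. \<bar>h (p (Suc n)) - h (p n)\<bar> powr q / \<bar>p (Suc n) - p n\<bar> powr (q - 1))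
             powr (1 / q)) \<le> ennreal (?J powr (1 / q))"
      using q by (intro ennreal_leI powr_mono2 sum_nonneg) auto
  qed
  define V where "V = enn2real (riesz_variation q h)"
  have V: "riesz_variation q h = ennreal V" "0 \<le> V"
    using le by (auto simp: V_def intro!: ennreal_enn2real[symmetric] elim: order_le_less_trans)
  have "AE x in lborel. x \<notin> X"
    using X by (intro AE_not_in) (simp add: finite_imp_null_set_lborel)
  then have "AE x in lborel. (h has_real_derivative g x) (at x)"
    by eventually_elim (rule D)
  from nn_integral_deriv_le_riesz_variation[OF q V(2) _ g this] V(1)
  have "ennreal ?J \<le> ennreal (V powr q)"
    using F by (simp add: nn_integral_eq_integral)
  then have "?J \<le> V powr q" by simp
  then have "?J powr (1 / q) \<le> (V powr q) powr (1 / q)"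
    using q by (intro powr_mono2) auto
  then show "ennreal (?J powr (1 / q)) \<le> riesz_variation q h"
    using V q by (simp add: powr_powr ennreal_leI)
qed

section \<open>Integrability and total variation\<close>

text \<open>The values of \<open>deriv\<close> at the corners of a maximal function are left
  undetermined. They form a finite, hence null, set, so an explicit Borel slope \<open>g\<close> can
  stand in for the derivative \<open>k\<close>.\<close>

lemma Lq_norm_finite_modification:
  fixes g k :: "real \<Rightarrow> real"
  assumes g: "g \<in> borel_measurable borel" and X: "finite X" and eq: "\<And>x. x \<notin> X \<Longrightarrow> k x = g x"
  shows "Lq_norm q k = (LINT x|lborel. \<bar>g x\<bar> powr q) powr (1 / q)"
    and "integrable lborel (\<lambda>x. \<bar>g x\<bar> powr q) \<Longrightarrow> k \<in> Lq_space q"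
proof -
  have gq: "(\<lambda>x. \<bar>g x\<bar> powr q) \<in> borel_measurable lborel" using g by simp
  have null: "emeasure lebesgue {x} = 0" for x :: real by simp
  have "(LINT x|lebesgue. \<bar>k x\<bar> powr q) = (LINT x|lebesgue. \<bar>g x\<bar> powr q)"
    by (rule integral_discrete_difference[of X]) (use X eq null in \<open>auto intro: countable_finite\<close>)
  also have "\<dots> = (LINT x|lborel. \<bar>g x\<bar> powr q)"
    using gq by (rule integral_completion)
  finally show "Lq_norm q k = (LINT x|lborel. \<bar>g x\<bar> powr q) powr (1 / q)"
    by (simp add: Lq_norm_def)
  assume "integrable lborel (\<lambda>x. \<bar>g x\<bar> powr q)"
  then have "integrable lebesgue (\<lambda>x. \<bar>g x\<bar> powr q)"
    using gq by (simp add: integrable_completion)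
  then have "integrable lebesgue (\<lambda>x. \<bar>k x\<bar> powr q)"
    by (subst integrable_discrete_difference[of X _ _ "\<lambda>x. \<bar>g x\<bar> powr q"])
       (use X eq null in \<open>auto intro: countable_finite\<close>)
  moreover have "k \<in> borel_measurable lebesgue"
    by (rule measurable_discrete_difference[of g _ _ X])
       (use X eq g in \<open>auto intro: countable_finite measurable_completion\<close>)
  ultimately show "k \<in> Lq_space q" by (simp add: Lq_space_def)
qed

lemma integrable_powr_one_plus_abs:
  fixes e :: real
  assumes "e < - 1"
  shows "integrable lborel (\<lambda>x::real. (1 + \<bar>x\<bar>) powr e)"
proof -
  define f where "f x = indicator {1..} x * x powr e" for x :: real
  have fm: "f \<in> borel_measurable borel" unfolding f_def by measurable
  have "(\<lambda>x::real. x powr e) integrable_on {1..}"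
    using has_integral_powr_to_inf[OF assms, of 1] by (auto simp: integrable_on_def)
  then have "(\<lambda>x::real. x powr e) absolutely_integrable_on {1..}"
    by (rule nonnegative_absolutely_integrable_1) simp
  then have f: "integrable lborel f"
    using fm by (simp add: set_integrable_def f_def[abs_def] integrable_completion)
  \<comment> \<open>One of \<open>1 + x\<close> and \<open>1 - x\<close> equals
    \<open>1 + \<bar>x\<bar>\<close>, so one of these nonnegative terms already dominates the
    function.\<close>
  have "integrable lborel (\<lambda>x. f (1 + 1 * x) + f (1 + (- 1) * x))"
    using f by (intro Bochner_Integration.integrable_add lborel_integrable_real_affine) auto
  then show ?thesis
  proof (rule Bochner_Integration.integrable_bound)
    show "AE x in lborel. norm ((1 + \<bar>x\<bar>) powr e) \<le> norm (f (1 + 1 * x) + f (1 + (- 1) * x))"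
      by (intro AE_I2) (auto simp: f_def indicator_def abs_if)
  qed measurable
qed

lemma integrable_powr_of_decay:
  fixes g :: "real \<Rightarrow> real"
  assumes "1 < q" "1 \<le> s" and g: "g \<in> borel_measurable borel"
    and le: "\<And>x. \<bar>g x\<bar> \<le> C * (1 + \<bar>x\<bar>) powr (- s)"
  shows "integrable lborel (\<lambda>x. \<bar>g x\<bar> powr q)"
proof -
  have C: "0 \<le> C"
    using order_trans[OF abs_ge_zero le[of 0]] by simp
  have "1 * 1 < s * q" using assms by (intro mult_le_less_imp_less) auto
  then have "integrable lborel (\<lambda>x::real. C powr q * (1 + \<bar>x\<bar>) powr (- s * q))"
    by (intro integrable_mult_right integrable_powr_one_plus_abs) auto
  then show ?thesis
  proof (rule Bochner_Integration.integrable_bound)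
    show "AE x in lborel. norm (\<bar>g x\<bar> powr q) \<le> norm (C powr q * (1 + \<bar>x\<bar>) powr (- s * q))"
    proof (rule AE_I2)
      fix x
      have "\<bar>g x\<bar> powr q \<le> (C * (1 + \<bar>x\<bar>) powr (- s)) powr q"
        using le[of x] \<open>1 < q\<close> by (intro powr_mono2) auto
      also have "\<dots> = C powr q * (1 + \<bar>x\<bar>) powr (- s * q)"
        using C by (simp add: powr_mult powr_powr)
      finally show "norm (\<bar>g x\<bar> powr q) \<le> norm (C powr q * (1 + \<bar>x\<bar>) powr (- s * q))"
        using C by simp
    qed
  qed (use g in measurable)
qed

text \<open>As in the Jordan decomposition, each increment of \<open>u - v\<close> is bounded by
  that of the monotone \<open>u + v\<close>, and these telescope.\<close>

lemma total_variation_diff_mono_le: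
  fixes u v :: "real \<Rightarrow> real"
  assumes "mono u" "mono v" "0 \<le> B" and B: "\<And>x y. (u y - u x) + (v y - v x) \<le> B"
  shows "total_variation (\<lambda>x. u x - v x) \<le> ennreal B"
  unfolding total_variation_def
proof (rule SUP_least, clarify)
  fix N and p :: "nat \<Rightarrow> real" assume "(N, p) \<in> partitions"
  then have less: "p n \<le> p (Suc n)" if "n < N" for n
    using that by (auto simp: partitions_def strict_mono_on_def intro!: less_imp_le)
  have "(\<Sum>n<N. \<bar>u (p (Suc n)) - v (p (Suc n)) - (u (p n) - v (p n))\<bar>)
      \<le> (\<Sum>n<N. (u (p (Suc n)) + v (p (Suc n))) - (u (p n) + v (p n)))"
  proof (rule sum_mono)
    fix n assume "n \<in> {..<N}"
    then have "u (p n) \<le> u (p (Suc n))" "v (p n) \<le> v (p (Suc n))"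
      using less assms by (auto simp: mono_def)
    then show "\<bar>u (p (Suc n)) - v (p (Suc n)) - (u (p n) - v (p n))\<bar>
        \<le> (u (p (Suc n)) + v (p (Suc n))) - (u (p n) + v (p n))" by linarith
  qed
  also have "\<dots> = (u (p N) + v (p N)) - (u (p 0) + v (p 0))"
    by (rule sum_lessThan_telescope)
  also have "\<dots> \<le> B" using B[where y="p N" and x="p 0"] by simp
  finally show "ennreal (\<Sum>n<N. \<bar>u (p (Suc n)) - v (p (Suc n)) - (u (p n) - v (p n))\<bar>) \<le> ennreal B"
    by (rule ennreal_leI)
qed

section \<open>Explicit maximal functions\<close>

text \<open>Here \<open>max \<bar>x\<bar> R + R\<close> is the length of the smallest interval
  containing \<open>x\<close> and \<open>[-R, R]\<close>. With \<open>s = 1 - \<beta>\<close> the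
  value is the fractional average of a mass \<open>T\<close> over that interval.\<close>

definition profile :: "real \<Rightarrow> real \<Rightarrow> real \<Rightarrow> real \<Rightarrow> real" where
  "profile s T R x = T / (max \<bar>x\<bar> R + R) powr s"

text \<open>At the possible corners \<open>\<bar>x\<bar> = R\<close> the chosen value is the outer
  one-sided slope.\<close>

definition profile_slope :: "real \<Rightarrow> real \<Rightarrow> real \<Rightarrow> real \<Rightarrow> real" where
  "profile_slope s T R x =
     (if \<bar>x\<bar> < R then 0 else - sgn x * (s * T * (\<bar>x\<bar> + R) powr (- s - 1)))"

lemma continuous_on_profile:
  assumes "0 < R"
  shows "continuous_on A (profile s T R)"
proof -
  have "max \<bar>x\<bar> R + R \<noteq> 0" for x using assms by (simp add: max_def)
  then show ?thesis
    unfolding profile_def[abs_def] by (intro continuous_intros) auto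
qed

lemma has_derivative_profile:
  assumes "0 < R" "x \<notin> {R, - R}"
  shows "(profile s T R has_real_derivative profile_slope s T R x) (at x)"
proof -
  consider "x \<in> {- R<..<R}" | "x \<in> {R<..}" | "x \<in> {..<- R}"
    using assms by force
  then show ?thesis
  proof cases
    case 1
    have "((\<lambda>x. T / (2 * R) powr s) has_real_derivative 0) (at x)" by simp
    then have "(profile s T R has_real_derivative 0) (at x)"
      by (rule has_field_derivative_transform_within_open[OF _ open_greaterThanLessThan 1])
         (auto simp: profile_def max_def)
    with 1 show ?thesis by (simp add: profile_slope_def abs_less_iff)
  next
    case 2
    have "((\<lambda>x. T * (x + R) powr (- s)) has_real_derivative T * (- s * (x + R) powr (- s - 1))) (at x)"
      using 2 assms by (auto intro!: derivative_eq_intros simp: powr_diff)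
    then have "(profile s T R has_real_derivative T * (- s * (x + R) powr (- s - 1))) (at x)"
      by (rule has_field_derivative_transform_within_open[OF _ open_greaterThan 2])
         (use assms in \<open>auto simp: profile_def max_def powr_minus divide_inverse\<close>)
    with 2 assms show ?thesis by (simp add: profile_slope_def mult_ac)
  next
    case 3
    have "((\<lambda>x. T * (R - x) powr (- s)) has_real_derivative T * (s * (R - x) powr (- s - 1))) (at x)"
      using 3 assms by (auto intro!: derivative_eq_intros simp: powr_diff)
    then have "(profile s T R has_real_derivative T * (s * (R - x) powr (- s - 1))) (at x)"
      by (rule has_field_derivative_transform_within_open[OF _ open_lessThan 3])
         (use assms in \<open>auto simp: profile_def max_def powr_minus divide_inverse\<close>)
    with 3 assms show ?thesis by (simp add: profile_slope_def mult_ac)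
  qed
qed

lemma borel_measurable_profile_slope [measurable]:
  "profile_slope s T R \<in> borel_measurable borel"
  unfolding profile_slope_def[abs_def] by measurable

lemma profile_slope_decay:
  assumes "0 < s" "0 \<le> T" "1 \<le> R"
  shows "\<bar>profile_slope s T R x\<bar> \<le> s * T * (1 + \<bar>x\<bar>) powr (- (s + 1))"
proof -
  have "(\<bar>x\<bar> + R) powr (- s - 1) \<le> (1 + \<bar>x\<bar>) powr (- s - 1)"
    using assms by (intro powr_mono2') auto
  then have "s * T * (\<bar>x\<bar> + R) powr (- s - 1) \<le> s * T * (1 + \<bar>x\<bar>) powr (- s - 1)"
    using assms by (intro mult_left_mono) auto
  then show ?thesis
    using assms by (auto simp: profile_slope_def abs_mult abs_sgn_eq)
qed

text \<open>
  If no interval inside the support \<open>[-R, R]\<close> of \<open>g\<close> beats \<open>[-R, R]\<close> itself, then at every point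
  the optimal interval is the smallest one containing that point and \<open>[-R, R]\<close>.
\<close>

lemma frac_maximal_eq_profile:
  fixes g :: "real \<Rightarrow> real"
  assumes "\<beta> < 1" "0 < R" "0 \<le> T"
    and supp: "\<And>x. R < \<bar>x\<bar> \<Longrightarrow> g x = 0"
    and mass: "(\<integral>\<^sup>+y\<in>{- R..R}. ennreal \<bar>g y\<bar> \<partial>lborel) = ennreal T"
    and bound: "\<And>a b. - R \<le> a \<Longrightarrow> a < b \<Longrightarrow> b \<le> R \<Longrightarrow>
      (\<integral>\<^sup>+y\<in>{a<..<b}. ennreal \<bar>g y\<bar> \<partial>lborel)
        \<le> ennreal (T / (2 * R) powr (1 - \<beta>) * (b - a) powr (1 - \<beta>))"
  shows "frac_maximal \<beta> g x = ennreal (profile (1 - \<beta>) T R x)"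
proof (rule antisym)
  define s where "s = 1 - \<beta>"
  have s: "0 < s" using assms by (simp add: s_def)
  define D where "D = max \<bar>x\<bar> R + R"
  have D: "2 * R \<le> D" by (simp add: D_def)
  show "frac_maximal \<beta> g x \<le> ennreal (profile (1 - \<beta>) T R x)"
    unfolding frac_maximal_def s_def[symmetric]
  proof (rule SUP_least, clarify)
    fix a b assume ab: "a < x" "x < b"
    define a' b' where "a' = max a (- R)" and "b' = min b R"
    \<comment> \<open>Clipping to an open interval may lose the points \<open>R\<close> and
      \<open>- R\<close>, where \<open>g\<close> need not vanish.\<close>
    have "AE y in lborel. y \<noteq> R" "AE y in lborel. y \<noteq> - R"
      by (rule AE_lborel_singleton)+
    then have eq: "(\<integral>\<^sup>+y\<in>{a<..<b}. ennreal \<bar>g y\<bar> \<partial>lborel) = (\<integral>\<^sup>+y\<in>{a'<..<b'}. ennreal \<bar>g y\<bar> \<partial>lborel)"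
      by (intro nn_integral_cong_AE, eventually_elim)
         (use supp in \<open>auto simp: indicator_def a'_def b'_def abs_if split: if_splits\<close>)
    show "(\<integral>\<^sup>+y\<in>{a<..<b}. ennreal \<bar>g y\<bar> \<partial>lborel) / ennreal ((b - a) powr s) \<le> ennreal (profile s T R x)"
    proof (cases "a' < b'")
      case True
      define u where "u = b' - a'"
      have u: "0 < u" "u \<le> 2 * R" using True by (auto simp: u_def a'_def b'_def)
      \<comment> \<open>\<open>D - 2 * R\<close> is the distance from \<open>x\<close> to
        \<open>[-R, R]\<close>; the interval must cover it in addition to its part of length
        \<open>u\<close> inside the support.\<close>
      have len: "u + (D - 2 * R) \<le> b - a"
        using True ab \<open>0 < R\<close> unfolding u_def D_def a'_def b'_def
        by (auto simp: max_def min_def abs_if split: if_splits)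
      \<comment> \<open>The difference of the two sides is \<open>(2 * R - u) * (D - 2 * R)\<close>,
        a product of nonnegative factors.\<close>
      have "u * D \<le> 2 * R * (u + (D - 2 * R))"
        using mult_right_mono[OF u(2), of "D - 2 * R"] D by (simp add: algebra_simps)
      also have "\<dots> \<le> 2 * R * (b - a)"
        using len \<open>0 < R\<close> by (intro mult_left_mono) auto
      finally have "u / (b - a) \<le> 2 * R / D"
        using ab D \<open>0 < R\<close> by (simp add: field_simps)
      then have "(u / (b - a)) powr s \<le> (2 * R / D) powr s"
        using u ab s by (intro powr_mono2) auto
      then have ineq: "T / (2 * R) powr s * ((u / (b - a)) powr s) \<le> T / (2 * R) powr s * ((2 * R / D) powr s)"
        using \<open>0 \<le> T\<close> by (intro mult_left_mono) auto
      have "(\<integral>\<^sup>+y\<in>{a<..<b}. ennreal \<bar>g y\<bar> \<partial>lborel) / ennreal ((b - a) powr s)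
          \<le> ennreal (T / (2 * R) powr s * u powr s) / ennreal ((b - a) powr s)"
        unfolding eq u_def s_def
        by (intro divide_right_mono_ennreal bound True) (auto simp: a'_def b'_def)
      also have "\<dots> = ennreal (T / (2 * R) powr s * u powr s / (b - a) powr s)"
        using \<open>0 \<le> T\<close> ab by (intro divide_ennreal) auto
      also have "\<dots> \<le> ennreal (profile s T R x)"
        using ineq u ab D \<open>0 < R\<close> unfolding profile_def D_def[symmetric]
        by (intro ennreal_leI) (simp add: powr_divide)
      finally show ?thesis .
    next
      case False
      then show ?thesis unfolding eq by simp
    qed
  qed
  have ge: "ennreal (T / (D + 2 * d) powr s) \<le> frac_maximal \<beta> g x" if "0 < d" for d
  proof -
    let ?a = "min x (- R) - d" and ?b = "max x R + d"
    have len: "?b - ?a = D + 2 * d" unfolding D_def using \<open>0 < R\<close> by (auto simp: max_def min_def abs_if)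
    have "ennreal T \<le> (\<integral>\<^sup>+y\<in>{?a<..<?b}. ennreal \<bar>g y\<bar> \<partial>lborel)"
      unfolding mass[symmetric] using that by (intro nn_integral_mono) (auto simp: indicator_def)
    then have "ennreal T / ennreal ((D + 2 * d) powr s)
        \<le> (\<integral>\<^sup>+y\<in>{?a<..<?b}. ennreal \<bar>g y\<bar> \<partial>lborel) / ennreal ((?b - ?a) powr s)"
      unfolding len by (rule divide_right_mono_ennreal)
    also have "\<dots> \<le> frac_maximal \<beta> g x"
      unfolding frac_maximal_def s_def[symmetric]
      by (rule SUP_upper2[of "(?a, ?b)"]) (use that in auto)
    finally show ?thesis using \<open>0 \<le> T\<close> that D \<open>0 < R\<close> by (simp add: divide_ennreal)
  qed
  have "((\<lambda>d. T / (D + 2 * d) powr s) \<longlongrightarrow> T / (D + 2 * 0) powr s) (at_right 0)"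
    using D \<open>0 < R\<close> by (intro tendsto_intros) auto
  then have "((\<lambda>d. ennreal (T / (D + 2 * d) powr s)) \<longlongrightarrow> ennreal (T / D powr s)) (at_right 0)"
    by (intro tendsto_ennrealI) simp
  then have "ennreal (T / D powr s) \<le> frac_maximal \<beta> g x"
    by (rule tendsto_upperbound) (auto simp: eventually_at_right_less intro: eventually_mono[OF eventually_at_right_less[of 0] ge])
  then show "ennreal (profile (1 - \<beta>) T R x) \<le> frac_maximal \<beta> g x"
    by (simp add: profile_def D_def s_def)
qed

section \<open>A central block on a wide plateau\<close>

definition tower :: "real \<Rightarrow> real \<Rightarrow> real \<Rightarrow> real \<Rightarrow> real" where
  "tower a c R x = a * indicator {-1..1} x + c * indicator {- R..R} x"

text \<open>Upward jumps go into \<open>?u\<close> and downward jumps into \<open>?v\<close>. For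
  \<open>R < 0\<close> the plateau is empty, while the difference of its two half-line indicators
  would take the value \<open>-1\<close>, so those terms are left out.\<close>

lemma total_variation_tower:
  assumes "0 \<le> a" "0 \<le> c"
  shows "total_variation (tower a c R) \<le> ennreal (2 * (a + c))"
proof (cases "0 \<le> R")
  case True
  let ?u = "\<lambda>x. a * indicator {-1..} x + c * indicator {- R..} x"
  let ?v = "\<lambda>x. a * indicator {1<..} x + c * indicator {R<..} x"
  have "total_variation (\<lambda>x. ?u x - ?v x) \<le> ennreal (2 * (a + c))"
    using assms by (intro total_variation_diff_mono_le) (auto simp: mono_def indicator_def)
  also have "(\<lambda>x. ?u x - ?v x) = tower a c R"
    using True by (auto simp: tower_def indicator_def)
  finally show ?thesis .
next
  case False
  let ?u = "\<lambda>x. a * indicator {-1..} x"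
  let ?v = "\<lambda>x. a * indicator {1<..} x"
  have "total_variation (\<lambda>x. ?u x - ?v x) \<le> ennreal (2 * (a + c))"
    using assms by (intro total_variation_diff_mono_le) (auto simp: mono_def indicator_def)
  also have "(\<lambda>x. ?u x - ?v x) = tower a c R"
    using False by (auto simp: tower_def indicator_def)
  finally show ?thesis .
qed

lemma tower_in_BV: "0 \<le> a \<Longrightarrow> 0 \<le> c \<Longrightarrow> tower a c R \<in> BV"
  using order_le_less_trans[OF total_variation_tower] by (simp add: BV_def)

lemma BV_norm_tower_le:
  assumes "0 \<le> a" "0 \<le> c"
  shows "BV_norm (tower a c R) \<le> 2 * (a + c)"
proof -
  have "\<forall>\<^sub>F x in at_bot. tower a c R x = 0"
    by (auto simp: tower_def indicator_def eventually_at_bot_linorder intro!: exI[of _ "min (- 1) (- R) - 1"])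
  then have "(tower a c R \<longlongrightarrow> 0) at_bot" by (rule tendsto_eventually)
  then have "Lim at_bot (tower a c R) = 0" by (intro tendsto_Lim) simp_all
  moreover have "enn2real (total_variation (tower a c R)) \<le> 2 * (a + c)"
    using assms total_variation_tower[of a c R] by (intro enn2real_leI) auto
  ultimately show ?thesis by (simp add: BV_norm_def)
qed

lemma nn_integral_tower:
  assumes "0 \<le> c" and A: "A \<in> sets borel"
  shows "(\<integral>\<^sup>+y\<in>A. ennreal \<bar>tower 1 c R y\<bar> \<partial>lborel)
    = emeasure lborel (A \<inter> {-1..1}) + ennreal c * emeasure lborel (A \<inter> {- R..R})"
proof -
  have "(\<integral>\<^sup>+y\<in>A. ennreal \<bar>tower 1 c R y\<bar> \<partial>lborel)
      = (\<integral>\<^sup>+y. indicator (A \<inter> {-1..1}) y + ennreal c * indicator (A \<inter> {- R..R}) y \<partial>lborel)"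
    using assms by (intro nn_integral_cong) (auto simp: tower_def indicator_def ennreal_plus)
  also have "\<dots> = emeasure lborel (A \<inter> {-1..1}) + ennreal c * emeasure lborel (A \<inter> {- R..R})"
    using A by (simp add: nn_integral_add nn_integral_cmult)
  finally show ?thesis .
qed

text \<open>
  For \<open>u \<ge> 2\<close> the left side is affine and the right side concave, so only the endpoints
  \<open>u = 2\<close> and \<open>u = 2R\<close> matter.
\<close>

lemma tower_mass_le:
  fixes R c \<beta> u :: real
  assumes \<beta>: "0 < \<beta>" "\<beta> < 1" and "0 \<le> c" "0 < u" "u \<le> 2 * R"
    and K: "K = (2 + 2 * R * c) / (2 * R) powr (1 - \<beta>)" and ge: "(1 + c) * 2 powr \<beta> \<le> K"
  shows "min 2 u + c * u \<le> K * u powr (1 - \<beta>)"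
proof (cases "u \<le> 2")
  case True
  \<comment> \<open>Up to length \<open>2\<close> the quotient is
    \<open>(1 + c) * u powr \<beta>\<close>, which is largest at \<open>u = 2\<close>;
    \<open>ge\<close> bounds it there.\<close>
  have "min 2 u + c * u = (1 + c) * u powr \<beta> * u powr (1 - \<beta>)"
    using True \<open>0 < u\<close> powr_add[of u \<beta> "1 - \<beta>"] by (simp add: algebra_simps)
  also have "\<dots> \<le> (1 + c) * 2 powr \<beta> * u powr (1 - \<beta>)"
    using True assms by (intro mult_right_mono mult_left_mono powr_mono2) auto
  also have "\<dots> \<le> K * u powr (1 - \<beta>)"
    using ge by (intro mult_right_mono) auto
  finally show ?thesis .
next
  case False
  define s where "s = 1 - \<beta>"
  have s: "0 < s" "s < 1" using \<beta> by (auto simp: s_def)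
  \<comment> \<open>Concavity of \<open>u powr s\<close> is used as convexity of its inverse
    \<open>x powr (1 / s)\<close>: in the coordinate \<open>z\<close>, the weight \<open>t\<close>
    places \<open>z\<close> between the endpoint values \<open>X\<close> and
    \<open>Y\<close>.\<close>
  define X Y z where "X = 2 powr s" and "Y = (2 * R) powr s" and "z = u powr s"
  have pos: "0 < X" "0 < Y" "0 < z" using assms by (auto simp: X_def Y_def z_def)
  have XY: "X < Y" "X \<le> z" "z \<le> Y"
    using s False assms unfolding X_def Y_def z_def by (auto intro!: powr_less_mono2 powr_mono2)
  define t where "t = (z - X) / (Y - X)"
  have "t * (Y - X) = z - X" using XY by (simp add: t_def)
  then have "z = (1 - t) * X + t * Y" by (simp add: algebra_simps)
  moreover have "0 \<le> t" "t \<le> 1" using XY by (simp_all add: t_def)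
  ultimately have t: "0 \<le> t" "t \<le> 1" "z = (1 - t) * X + t * Y" by blast+
  have inv: "X powr (1 / s) = 2" "Y powr (1 / s) = 2 * R" "z powr (1 / s) = u"
    using s assms by (auto simp: X_def Y_def z_def powr_powr)
  have "convex_on {0<..} (\<lambda>x::real. x powr (1 / s))" using s by (intro powr_convex) simp
  from convex_onD[OF this t(1,2), of X Y] pos t(3)
  have "z powr (1 / s) \<le> (1 - t) * X powr (1 / s) + t * Y powr (1 / s)" by simp
  then have "u \<le> (1 - t) * 2 + t * (2 * R)" unfolding inv .
  then have "2 + c * u \<le> 2 + c * ((1 - t) * 2 + t * (2 * R))"
    using \<open>0 \<le> c\<close> by (intro add_left_mono mult_left_mono) auto
  also have "\<dots> = (1 - t) * (2 + 2 * c) + t * (2 + 2 * R * c)" by (simp add: algebra_simps)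
  \<comment> \<open>At \<open>X\<close> the bound is \<open>ge\<close>; at \<open>Y\<close> it is an
    equality, by the choice of \<open>K\<close>.\<close>
  also have "\<dots> \<le> (1 - t) * (K * X) + t * (K * Y)"
  proof (intro add_mono mult_left_mono)
    have "2 + 2 * c = (1 + c) * 2 powr \<beta> * X"
      using powr_add[of 2 \<beta> s] by (simp add: X_def s_def algebra_simps)
    also have "\<dots> \<le> K * X" using ge pos by (intro mult_right_mono) auto
    finally show "2 + 2 * c \<le> K * X" .
    show "2 + 2 * R * c \<le> K * Y" using pos unfolding K s_def[symmetric] Y_def[symmetric] by simp
  qed (use t in auto)
  also have "\<dots> = K * z" unfolding t(3) by (simp add: algebra_simps)
  finally show ?thesis using False by (simp add: z_def s_def)
qed

text \<open>The two sides of \<open>ge\<close> are the fractional averages over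
  \<open>[-1, 1]\<close> and \<open>[-R, R]\<close>. These are the only competitors, so comparing
  them decides that \<open>[-R, R]\<close> is optimal.\<close>

lemma frac_maximal_tower:
  fixes R c \<beta> :: real
  assumes \<beta>: "0 < \<beta>" "\<beta> < 1" and "0 \<le> c" "1 \<le> R"
    and ge: "(1 + c) * 2 powr \<beta> \<le> (2 + 2 * R * c) / (2 * R) powr (1 - \<beta>)"
  shows "frac_maximal \<beta> (tower 1 c R) x = ennreal (profile (1 - \<beta>) (2 + 2 * R * c) R x)"
proof (rule frac_maximal_eq_profile)
  show "(\<integral>\<^sup>+y\<in>{- R..R}. ennreal \<bar>tower 1 c R y\<bar> \<partial>lborel) = ennreal (2 + 2 * R * c)"
  proof -
    have "{- R..R} \<inter> {-1..1} = {-1..1::real}" "0 \<le> R" using assms by auto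
    then show ?thesis
      using assms by (subst nn_integral_tower) (auto simp: ennreal_mult[symmetric] mult_ac)
  qed
  fix a b assume ab: "- R \<le> a" "a < b" "b \<le> R"
  have "emeasure lborel ({a<..<b} \<inter> {-1..1}) \<le> emeasure lborel {-1..1::real}"
       "emeasure lborel ({a<..<b} \<inter> {-1..1}) \<le> emeasure lborel {a<..<b}"
    by (intro emeasure_mono; auto)+
  then have 1: "emeasure lborel ({a<..<b} \<inter> {-1..1}) \<le> ennreal (min 2 (b - a))"
    using ab by (auto simp: min_def)
  have "{a<..<b} \<inter> {- R..R} = {a<..<b}" using ab by auto
  then have "(\<integral>\<^sup>+y\<in>{a<..<b}. ennreal \<bar>tower 1 c R y\<bar> \<partial>lborel) \<le> ennreal (min 2 (b - a)) + ennreal c * ennreal (b - a)"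
    using assms ab 1 by (subst nn_integral_tower) (auto intro!: add_mono)
  also have "\<dots> = ennreal (min 2 (b - a) + c * (b - a))"
    using assms ab by (simp add: ennreal_mult ennreal_plus)
  also have "\<dots> \<le> ennreal ((2 + 2 * R * c) / (2 * R) powr (1 - \<beta>) * (b - a) powr (1 - \<beta>))"
    using assms ab by (intro ennreal_leI tower_mass_le[OF \<beta> _ _ _ refl ge]) auto
  finally show "(\<integral>\<^sup>+y\<in>{a<..<b}. ennreal \<bar>tower 1 c R y\<bar> \<partial>lborel)
      \<le> ennreal ((2 + 2 * R * c) / (2 * R) powr (1 - \<beta>) * (b - a) powr (1 - \<beta>))" .
qed (use assms in \<open>auto simp: tower_def indicator_def\<close>)

lemma frac_maximal_facts_of_profile:
  assumes M: "\<And>x. frac_maximal \<beta> g x = ennreal (profile s T R x)" and "0 < R" "0 \<le> T"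
  shows "frac_maximal_real \<beta> g = profile s T R"
    and "x \<notin> {R, - R} \<Longrightarrow> frac_maximal_deriv \<beta> g x = profile_slope s T R x"
    and "AE x in lebesgue. frac_maximal_real \<beta> g differentiable (at x)"
proof -
  show real: "frac_maximal_real \<beta> g = profile s T R"
    using assms by (auto simp: frac_maximal_real_def profile_def)
  show "frac_maximal_deriv \<beta> g x = profile_slope s T R x" if "x \<notin> {R, - R}"
    using DERIV_imp_deriv[OF has_derivative_profile[OF \<open>0 < R\<close> that]]
    by (simp add: frac_maximal_deriv_def real M)
  have "AE x in lborel. x \<noteq> R" "AE x in lborel. x \<noteq> - R"
    by (rule AE_lborel_singleton)+
  then have "AE x in lborel. frac_maximal_real \<beta> g differentiable (at x)"
    by eventually_elim
       (use has_derivative_profile[OF \<open>0 < R\<close>] in \<open>auto simp: real real_differentiable_def\<close>)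
  then show "AE x in lebesgue. frac_maximal_real \<beta> g differentiable (at x)"
    by (rule AE_completion)
qed

section \<open>The counterexample\<close>

theorem theorem3:
  fixes \<beta> q :: real
  assumes "0 < \<beta>" and "\<beta> < 1" and "q = 1 / (1 - \<beta>)"
  shows "\<exists>(fs :: nat \<Rightarrow> real \<Rightarrow> real) (f :: real \<Rightarrow> real).
    (\<forall>j. fs j \<in> BV) \<and> f \<in> BV \<and>
    (\<lambda>j. BV_norm (\<lambda>x. fs j x - f x)) \<longlonglongrightarrow> 0 \<and>
    (\<forall>j x. frac_maximal \<beta> (fs j) x < \<infinity>) \<and> (\<forall>x. frac_maximal \<beta> f x < \<infinity>) \<and>
    (\<forall>j. AE x in lebesgue. frac_maximal_real \<beta> (fs j) differentiable (at x)) \<and>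
    (AE x in lebesgue. frac_maximal_real \<beta> f differentiable (at x)) \<and>
    (\<forall>j. frac_maximal_deriv \<beta> (fs j) \<in> Lq_space q) \<and> frac_maximal_deriv \<beta> f \<in> Lq_space q \<and>
    (\<forall>j. ennreal (Lq_norm q (\<lambda>x. frac_maximal_deriv \<beta> (fs j) x - frac_maximal_deriv \<beta> f x))
         = riesz_variation q (\<lambda>x. frac_maximal_real \<beta> (fs j) x - frac_maximal_real \<beta> f x)) \<and>
    \<not> (\<lambda>j. Lq_norm q (\<lambda>x. frac_maximal_deriv \<beta> (fs j) x - frac_maximal_deriv \<beta> f x))
        \<longlonglongrightarrow> 0"
proof -
  define s where "s = 1 - \<beta>"
  have s: "0 < s" using assms by (simp add: s_def)
  have q: "1 < q" using assms by simp
  \<comment> \<open>The height tends to \<open>0\<close>, while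
    \<open>R j powr \<beta> = real j + 2\<close> gives
    \<open>c j * R j powr \<beta> = 1 + c j\<close>. Hence the plateau's mass alone already matches
    the average over \<open>[-1, 1]\<close>.\<close>
  define c :: "nat \<Rightarrow> real" where "c j = 1 / (real j + 1)" for j
  define R :: "nat \<Rightarrow> real" where "R j = (real j + 2) powr (1 / \<beta>)" for j
  define T where "T j = 2 + 2 * R j * c j" for j
  define fs where "fs j = tower 1 (c j) (R j)" for j
  define f where "f = tower 1 0 1"
  have c: "0 \<le> c j" for j by (simp add: c_def)
  have R: "2 \<le> R j" for j
  proof -
    have "(real j + 2) powr 1 \<le> (real j + 2) powr (1 / \<beta>)"
      using assms by (intro powr_mono) auto
    then show ?thesis by (simp add: R_def)
  qed
  have T: "0 \<le> T j" for j using c[of j] R[of j] by (simp add: T_def)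
  have ge: "(1 + c j) * 2 powr \<beta> \<le> (2 + 2 * R j * c j) / (2 * R j) powr (1 - \<beta>)" for j
  proof -
    have "1 + c j = c j * (real j + 2)" by (simp add: c_def field_simps)
    also have "real j + 2 = R j powr \<beta>" using assms by (simp add: R_def powr_powr)
    finally have "(1 + c j) * 2 powr \<beta> = c j * (2 * R j) powr \<beta>"
      using R[of j] by (simp add: powr_mult)
    also have "\<dots> = 2 * R j * c j / (2 * R j) powr (1 - \<beta>)"
      using R[of j] by (simp add: powr_diff)
    also have "\<dots> \<le> (2 + 2 * R j * c j) / (2 * R j) powr (1 - \<beta>)"
      by (intro divide_right_mono) auto
    finally show ?thesis .
  qed
  have Mj: "frac_maximal \<beta> (fs j) x = ennreal (profile s (T j) (R j) x)" for j x
    unfolding fs_def T_def s_def using assms c[of j] R[of j] ge[of j] by (intro frac_maximal_tower) auto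
  \<comment> \<open>With \<open>c = 0\<close> and \<open>R = 1\<close> the plateau is absent and the
    comparison of averages is an equality.\<close>
  have M: "frac_maximal \<beta> f x = ennreal (profile s 2 1 x)" for x
    using frac_maximal_tower[of \<beta> 0 1 x] assms by (simp add: f_def s_def powr_diff)
  have R0: "0 < R j" for j using R[of j] by simp
  note Mj_facts = frac_maximal_facts_of_profile[OF Mj R0 T]
  note M_facts = frac_maximal_facts_of_profile[OF M zero_less_one zero_le_numeral]
  \<comment> \<open>The central blocks cancel, so the difference is itself a tower, with block
    height \<open>0\<close>.\<close>
  have BVj: "BV_norm (\<lambda>x. fs j x - f x) \<le> 2 * c j" for j
    using BV_norm_tower_le[of 0 "c j" "R j"] c[of j] by (simp add: fs_def f_def tower_def[abs_def])
  define h where "h j x = profile s (T j) (R j) x - profile s 2 1 x" for j x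
  define g where "g j x = profile_slope s (T j) (R j) x - profile_slope s 2 1 x" for j x
  have gm: "g j \<in> borel_measurable borel" for j unfolding g_def by measurable
  have Fj: "integrable lborel (\<lambda>x. \<bar>profile_slope s (T j) (R j) x\<bar> powr q)" for j
    using profile_slope_decay[OF s T, of "R j" j] R[of j] s
    by (intro integrable_powr_of_decay[OF q, of "s + 1"]) auto
  have F: "integrable lborel (\<lambda>x. \<bar>profile_slope s 2 1 x\<bar> powr q)"
    using profile_slope_decay[OF s, of 2 1] s
    by (intro integrable_powr_of_decay[OF q, of "s + 1"]) auto
  have Fg: "integrable lborel (\<lambda>x. \<bar>g j x\<bar> powr q)" for j
  proof (rule integrable_powr_of_decay[OF q _ gm, of "s + 1" j "s * T j + s * 2"])
    fix x
    have "\<bar>g j x\<bar> \<le> \<bar>profile_slope s (T j) (R j) x\<bar> + \<bar>profile_slope s 2 1 x\<bar>"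
      unfolding g_def by (rule abs_triangle_ineq4)
    also have "\<dots> \<le> s * T j * (1 + \<bar>x\<bar>) powr (- (s + 1)) + s * 2 * (1 + \<bar>x\<bar>) powr (- (s + 1))"
      using profile_slope_decay[OF s T, of "R j" j x] profile_slope_decay[OF s, of 2 1 x] R[of j]
      by (intro add_mono) auto
    finally show "\<bar>g j x\<bar> \<le> (s * T j + s * 2) * (1 + \<bar>x\<bar>) powr (- (s + 1))"
      by (simp add: distrib_right)
  qed (use s in simp)
  have norm_eq: "Lq_norm q (\<lambda>x. frac_maximal_deriv \<beta> (fs j) x - frac_maximal_deriv \<beta> f x)
      = (LINT x|lborel. \<bar>g j x\<bar> powr q) powr (1 / q)" for j
    by (rule Lq_norm_finite_modification(1)[OF gm, where X = "{R j, - R j, 1, - 1}"])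
       (use Mj_facts(2) M_facts(2) in \<open>auto simp: g_def\<close>)
  have riesz: "riesz_variation q (h j) = ennreal ((LINT x|lborel. \<bar>g j x\<bar> powr q) powr (1 / q))" for j
  proof (rule riesz_variation_eq_Lq_norm[OF q _ _ _ gm Fg])
    show "continuous_on UNIV (h j)"
      unfolding h_def using R0 by (intro continuous_intros continuous_on_profile) auto
    show "(h j has_real_derivative g j x) (at x)" if "x \<notin> {R j, - R j, 1, - 1}" for x
      unfolding h_def g_def using that R0[of j] by (intro DERIV_diff has_derivative_profile) auto
  qed simp
  \<comment> \<open>This is the drop of the maximal function of \<open>f\<close> from
    \<open>1\<close> to \<open>2\<close>. Since \<open>2 \<le> R j\<close>, the maximal function of
    \<open>fs j\<close> is constant there, so the drop survives in the difference for every
    \<open>j\<close>.\<close>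
  define \<kappa> where "\<kappa> = 2 / 2 powr s - 2 / 3 powr s"
  have \<kappa>: "0 < \<kappa>" using s by (simp add: \<kappa>_def powr_less_mono2 frac_less2)
  have lower: "\<kappa> \<le> Lq_norm q (\<lambda>x. frac_maximal_deriv \<beta> (fs j) x - frac_maximal_deriv \<beta> f x)" for j
  proof -
    have "h j 2 - h j 1 = \<kappa>" using R[of j] by (simp add: h_def profile_def \<kappa>_def)
    \<comment> \<open>The partition with the two points \<open>1\<close> and \<open>2\<close>
      suffices: its step is \<open>1\<close>, so the Riesz quotient is
      \<open>\<kappa> powr q\<close>.\<close>
    then have "ennreal \<kappa> = ennreal ((\<Sum>n<1. \<bar>h j (real (Suc n) + 1) - h j (real n + 1)\<bar> powr q
        / \<bar>(real (Suc n) + 1) - (real n + 1)\<bar> powr (q - 1)) powr (1 / q))"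
      using \<kappa> q by (simp add: powr_powr)
    also have "\<dots> \<le> riesz_variation q (h j)"
      unfolding riesz_variation_def
      by (rule SUP_upper2[of "(1, \<lambda>n. real n + 1)"]) (auto simp: partitions_def strict_mono_on_def)
    finally show ?thesis unfolding riesz norm_eq by simp
  qed
  show ?thesis
  proof (intro exI[of _ fs] exI[of _ f] conjI allI)
    show "(\<lambda>j. BV_norm (\<lambda>x. fs j x - f x)) \<longlonglongrightarrow> 0"
    proof (rule tendsto_sandwich[OF _ _ tendsto_const])
      show "(\<lambda>j. 2 * c j) \<longlonglongrightarrow> 0"
        using tendsto_mult_right_zero[OF LIMSEQ_inverse_real_of_nat, of 2] by (simp add: c_def inverse_eq_divide add.commute)
    qed (use BVj in \<open>auto simp: BV_norm_def\<close>)
    show "ennreal (Lq_norm q (\<lambda>x. frac_maximal_deriv \<beta> (fs j) x - frac_maximal_deriv \<beta> f x))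
         = riesz_variation q (\<lambda>x. frac_maximal_real \<beta> (fs j) x - frac_maximal_real \<beta> f x)" for j
      using riesz[of j] unfolding norm_eq Mj_facts(1) M_facts(1) by (simp add: h_def[abs_def])
    show "\<not> (\<lambda>j. Lq_norm q (\<lambda>x. frac_maximal_deriv \<beta> (fs j) x - frac_maximal_deriv \<beta> f x))
        \<longlonglongrightarrow> 0"
      using LIMSEQ_le_const[of _ 0 \<kappa>] lower \<kappa> by force
    show "frac_maximal_deriv \<beta> (fs j) \<in> Lq_space q" for j
      by (rule Lq_norm_finite_modification(2)[OF _ _ _ Fj, where X = "{R j, - R j}"])
         (use Mj_facts(2) in auto)
    show "frac_maximal_deriv \<beta> f \<in> Lq_space q"
      by (rule Lq_norm_finite_modification(2)[OF _ _ _ F, where X = "{1, - 1}"])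
         (use M_facts(2) in auto)
  qed (use Mj M Mj_facts(3) M_facts(3) c in \<open>auto simp: fs_def f_def intro: tower_in_BV\<close>)
qed

end
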